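(* For every infinite cardinal $\kappa$ and every natural number $n<\omega$, there is a digraph $D$ with $|V(D)| = 2^{\kappa}$ whose dichromatic number is at least $\kappa^{+}$ and which does not contain a directed cycle of length less than $n$.
   Context: A digraph $D$ is a set of ordered pairs $uv$ of distinct vertices (no loops); its vertex set $V(D)$ is the set of all vertices occurring in these pairs. A directed cycle of length $m$ ($2\le m<\omega$) is a digraph of the form $\{v_k v_{k+1} : k<m\}$ with indices taken mod $m$ and $v_0,\dots,v_{m-1}$ pairwise distinct; $D$ contains it if it is a subset of $D$. The dichromatic number $\chi(D)$ of a digraph $D$ is the smallest cardinal $\lambda$ such that $V(D)$ can be coloured with $\lambda$ colours so that there is no monochromatic directed cycle (i.e., no directed cycle contained in $D$ all of whose vertices receive the same colour). *)

theory Defs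
  imports Main
begin

unbundle cardinal_syntax

text \<open>
  A digraph is its set of arcs; its vertex set is the field of this relation, so there are no
  isolated vertices.
\<close>

definition digraph :: "'v rel \<Rightarrow> bool" where
  "digraph D \<longleftrightarrow> irrefl D"

abbreviation (input) verts :: "'v rel \<Rightarrow> 'v set" where
  "verts D \<equiv> Field D"

definition directed_cycle :: "nat \<Rightarrow> 'v rel \<Rightarrow> bool" where
  "directed_cycle m C \<longleftrightarrow> 2 \<le> m \<and>
    (\<exists>v :: nat \<Rightarrow> 'v. inj_on v {..<m} \<and> C = {(v k, v (Suc k mod m)) | k. k < m})"

definition monochromatic :: "('v \<Rightarrow> 'c) \<Rightarrow> 'v rel \<Rightarrow> bool" where
  "monochromatic c C \<longleftrightarrow> (\<exists>a. \<forall>x\<in>verts C. c x = a)"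

text \<open>
  The colours are the elements of the field of a cardinal \<open>\<nu>\<close>, given as a cardinal order on
  an arbitrary type.
\<close>

definition colourable :: "'v rel \<Rightarrow> 'c rel \<Rightarrow> bool" where
  "colourable D \<nu> \<longleftrightarrow> (\<exists>c. (\<forall>x\<in>verts D. c x \<in> Field \<nu>) \<and>
    (\<forall>m C. directed_cycle m C \<and> C \<subseteq> D \<longrightarrow> \<not> monochromatic c C))"

definition is_dichromatic_number :: "'v rel \<Rightarrow> 'v rel \<Rightarrow> bool" where
  "is_dichromatic_number D \<nu> \<longleftrightarrow> Card_order \<nu> \<and> colourable D \<nu> \<and>
    (\<forall>\<mu> :: 'v rel. Card_order \<mu> \<and> colourable D \<mu> \<longrightarrow> \<nu> \<le>o \<mu>)"

text \<open>
  The least cardinal is chosen among the cardinal orders on the vertex type. Such a cardinal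
  exists, because colouring every vertex with itself is admissible, and it is least among the
  cardinals on all types; see the lemmas below.
\<close>

definition dichromatic_number :: "'v rel \<Rightarrow> 'v rel" where
  "dichromatic_number D = (SOME \<nu>. is_dichromatic_number D \<nu>)"

lemma colourable_mono:
  assumes "colourable D \<nu>" "\<nu> \<le>o \<mu>"
  shows "colourable D \<mu>"
proof -
  obtain c where c: "\<forall>x\<in>verts D. c x \<in> Field \<nu>"
    "\<forall>m C. directed_cycle m C \<and> C \<subseteq> D \<longrightarrow> \<not> monochromatic c C"
    using assms(1) unfolding colourable_def by blast
  obtain f where f: "inj_on f (Field \<nu>)" "f ` Field \<nu> \<subseteq> Field \<mu>"
    using card_of_mono2[OF assms(2)] unfolding card_of_ordLeq[symmetric] by blast
  have "\<not> monochromatic (f \<circ> c) C" if "directed_cycle m C" "C \<subseteq> D" for m C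
  proof
    assume mono: "monochromatic (f \<circ> c) C"
    have sub: "verts C \<subseteq> verts D" using that(2) by (rule mono_Field)
    have "c x = c y" if "x \<in> verts C" "y \<in> verts C" for x y
    proof (rule inj_onD[OF f(1)])
      show "f (c x) = f (c y)" using mono that unfolding monochromatic_def by fastforce
    qed (use that sub c(1) in blast)+
    then have "monochromatic c C" unfolding monochromatic_def by blast
    then show False using c(2) that by blast
  qed
  moreover have "\<forall>x\<in>verts D. (f \<circ> c) x \<in> Field \<mu>" using c(1) f(2) by auto
  ultimately show ?thesis unfolding colourable_def by blast
qed

lemma colourable_card_of_verts: "colourable D |verts D|"
proof -
  have "\<not> monochromatic (\<lambda>x. x) C" if cyc: "directed_cycle m C" for m and C :: "'a rel"
  proof -
    obtain v where m: "2 \<le> m" and v: "inj_on v {..<m}"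
      "C = {(v k, v (Suc k mod m)) | k. k < m}"
      using cyc unfolding directed_cycle_def by blast
    have "(v 0, v (Suc 0 mod m)) \<in> C" using m v(2) by auto
    then have "v 0 \<in> verts C" "v 1 \<in> verts C" using m by (auto simp: Field_def)
    moreover have "v 0 \<noteq> v 1" using m inj_onD[OF v(1), of 0 1] by auto
    ultimately show ?thesis unfolding monochromatic_def by metis
  qed
  then show ?thesis unfolding colourable_def by (intro exI[of _ "\<lambda>x. x"]) (auto simp: Field_card_of)
qed

lemma is_dichromatic_number_dichromatic_number:
  fixes D :: "'v rel"
  shows "is_dichromatic_number D (dichromatic_number D)"
proof -
  let ?R = "{\<mu> :: 'v rel. Card_order \<mu> \<and> colourable D \<mu>}"
  have "|verts D| \<in> ?R" by (simp add: colourable_card_of_verts card_of_Card_order)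
  then have "?R \<noteq> {}" by blast
  moreover have "\<forall>\<mu>\<in>?R. Card_order \<mu>" by simp
  ultimately have "\<exists>\<nu>\<in>?R. \<forall>\<mu>\<in>?R. \<nu> \<le>o \<mu>" by (rule exists_minim_Card_order)
  then obtain \<nu> where "\<nu> \<in> ?R" "\<forall>\<mu>\<in>?R. \<nu> \<le>o \<mu>" by blast
  then have "is_dichromatic_number D \<nu>" unfolding is_dichromatic_number_def by simp
  then show ?thesis unfolding dichromatic_number_def by (rule someI)
qed

lemma dichromatic_number_Card_order: "Card_order (dichromatic_number D)"
  and dichromatic_number_colourable: "colourable D (dichromatic_number D)"
  using is_dichromatic_number_dichromatic_number[of D] unfolding is_dichromatic_number_def by auto

lemma dichromatic_number_least:
  fixes D :: "'v rel" and \<mu> :: "'c rel"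
  assumes "Card_order \<mu>" "colourable D \<mu>"
  shows "dichromatic_number D \<le>o \<mu>"
proof (rule ccontr)
  assume "\<not> dichromatic_number D \<le>o \<mu>"
  then have less: "\<mu> <o dichromatic_number D"
    using assms(1) dichromatic_number_Card_order not_ordLeq_iff_ordLess by (metis card_order_on_well_order_on)
  then have "|Field \<mu>| \<le>o |Field (dichromatic_number D)|"
    by (intro card_of_mono2 ordLess_imp_ordLeq)
  then obtain f :: "'c \<Rightarrow> 'v" where f: "inj_on f (Field \<mu>)" unfolding card_of_ordLeq[symmetric] by blast
  have iso: "\<mu> =o |f ` Field \<mu>|"
  proof -
    have "|Field \<mu>| =o |f ` Field \<mu>|"
      using f card_of_ordIso[of "Field \<mu>" "f ` Field \<mu>"] inj_on_imp_bij_betw by blast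
    then show ?thesis
      using ordIso_transitive[OF ordIso_symmetric[OF card_of_Field_ordIso[OF assms(1)]]] by blast
  qed
  then have "colourable D |f ` Field \<mu>|"
    by (rule colourable_mono[OF assms(2) ordIso_imp_ordLeq])
  then have "dichromatic_number D \<le>o |f ` Field \<mu>|"
    using is_dichromatic_number_dichromatic_number[of D] card_of_Card_order
    unfolding is_dichromatic_number_def by blast
  then have "dichromatic_number D \<le>o \<mu>"
    by (rule ordLeq_ordIso_trans[OF _ ordIso_symmetric[OF iso]])
  then show False using less not_ordLess_ordLeq by blast
qed

end

(* Vertices are sequences of length \<kappa> with entries in Z/N, N > n, and x \<rightarrow> y iff the
   entry of y exceeds the entry of x by 1 modulo N at the first place where they differ. At the
   first place where the vertices of a directed cycle do not all agree, each step adds 0 or 1, so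
   the cycle winds around Z/N and has length at least N. Given a colouring with colours i < \<kappa>
   and no monochromatic directed cycle, build a sequence x recursively: among the N cones given by
   the possible values of x i, one avoids colour i, since otherwise vertices of colour i, one from
   each cone, form a directed cycle. Choose such a value at every place; then x has no colour.
   Subsets X of \<kappa> stand in for the sequences through a surjection X \<mapsto> f X; two vertices may
   code the same sequence, which does no harm. *)
theory Submission
  imports Defs
begin

text \<open>This lets subsets of \<open>F\<close> serve as vertices, so that the vertex set is a
  full power set. An injection \<open>p\<close> of \<open>F \<times> UNIV\<close> into
  \<open>F\<close> reserves infinitely many elements of \<open>F\<close> for each place
  \<open>i\<close>, and a set \<open>X\<close> stores the entry at \<open>i\<close> in unary among
  them.\<close>

lemma ex_onto_bounded_functions:
  fixes F :: "'a set" and N :: nat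
  assumes "infinite F" "0 < N"
  shows "\<exists>f :: 'a set \<Rightarrow> 'a \<Rightarrow> nat. (\<forall>X i. f X i < N) \<and>
    (\<forall>x. (\<forall>i\<in>F. x i < N) \<longrightarrow> (\<exists>X\<subseteq>F. \<forall>i\<in>F. f X i = x i))"
proof -
  have "|UNIV :: nat set| \<le>o |F|"
    using assms(1) by (simp add: infinite_iff_card_of_nat)
  then have "|F \<times> (UNIV :: nat set)| \<le>o |F|"
    using card_of_Times_infinite[OF assms(1) UNIV_not_empty] ordIso_imp_ordLeq by blast
  then obtain p where p: "inj_on p (F \<times> (UNIV :: nat set))" "p ` (F \<times> UNIV) \<subseteq> F"
    unfolding card_of_ordLeq[symmetric] by blast
  \<comment> \<open>Only \<open>N - 1\<close> of the elements reserved for \<open>i\<close> are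
    counted, so every set, not just a proper code, yields entries below \<open>N\<close>.\<close>
  define f where "f X i = card {m. m < N - 1 \<and> p (i, m) \<in> X}" for X i
  have "f X i < N" for X i
  proof -
    have "card {m. m < N - 1 \<and> p (i, m) \<in> X} \<le> card {..<N - 1}"
      by (rule card_mono) auto
    then show ?thesis using assms(2) unfolding f_def by simp
  qed
  moreover have "\<exists>X\<subseteq>F. \<forall>i\<in>F. f X i = x i" if x: "\<forall>i\<in>F. x i < N" for x
  proof (intro exI conjI ballI)
    let ?X = "{p (i, m) | i m. i \<in> F \<and> m < x i}"
    show "?X \<subseteq> F" using p(2) by auto
    fix i assume i: "i \<in> F"
    have "p (i, m) \<in> ?X \<longleftrightarrow> m < x i" for m
      using i p(1) by (auto simp: inj_on_def)
    then have "{m. m < N - 1 \<and> p (i, m) \<in> ?X} = {..<x i}"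
      using x i by fastforce
    then show "f ?X i = x i" unfolding f_def by simp
  qed
  ultimately show ?thesis by blast
qed

text \<open>Modulo \<open>N\<close>, \<open>a k\<close> is \<open>a 0\<close> plus the number of
  proper steps before \<open>k\<close>. Closing up makes the total number of proper steps a multiple
  of \<open>N\<close>; it is positive and at most \<open>m\<close>.\<close>

lemma cyclic_walk_winds:
  fixes a :: "nat \<Rightarrow> nat"
  assumes step: "\<And>k. k < m \<Longrightarrow> a (Suc k) = a k \<or> a (Suc k) = Suc (a k) mod N"
    and closed: "a m = a 0" and lt: "a 0 < N" and nonconst: "\<exists>k<m. a (Suc k) \<noteq> a k"
  shows "N \<le> m"
proof -
  let ?S = "\<lambda>k. {l. l < k \<and> a (Suc l) \<noteq> a l}"
  have fin: "finite (?S k)" for k by simp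
  have "a k = (a 0 + card (?S k)) mod N" if "k \<le> m" for k
    using that
  proof (induction k)
    case 0
    then show ?case using lt by simp
  next
    case (Suc k)
    have S: "?S (Suc k) = (if a (Suc k) = a k then ?S k else insert k (?S k))"
      by (auto simp: less_Suc_eq)
    show ?case
    proof (cases "a (Suc k) = a k")
      case True
      then show ?thesis using Suc S by simp
    next
      case False
      then have "a (Suc k) = Suc (a k) mod N" using step[of k] Suc.prems by simp
      moreover have "card (?S (Suc k)) = Suc (card (?S k))" using False S fin by simp
      moreover have "a k = (a 0 + card (?S k)) mod N" using Suc by simp
      ultimately show ?thesis by (simp add: mod_Suc_eq)
    qed
  qed
  from this[of m] have "(a 0 + card (?S m)) mod N = (a 0 + 0) mod N"
    using closed lt by simp
  then have "N dvd card (?S m)"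
    using mod_eq_dvd_iff_nat[of "a 0" "a 0 + card (?S m)" N] by simp
  moreover have "0 < card (?S m)" using nonconst by (auto simp: card_gt_0_iff)
  ultimately have "N \<le> card (?S m)" by (simp add: dvd_imp_le)
  also have "card (?S m) \<le> card {..<m}" by (rule card_mono) auto
  finally show ?thesis by simp
qed

text \<open>For entries below \<open>N\<close> with 2 \<le> \<open>N\<close>, a value differs from
  its successor modulo \<open>N\<close>, so the witness \<open>i\<close> is the first place where
  \<open>f x\<close> and \<open>f y\<close> differ.\<close>

definition first_difference_digraph :: "'a rel \<Rightarrow> nat \<Rightarrow> ('v \<Rightarrow> 'a \<Rightarrow> nat) \<Rightarrow> 'v set \<Rightarrow> 'v rel" where
  "first_difference_digraph r N f V = {(x, y). x \<in> V \<and> y \<in> V \<and>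
    (\<exists>i\<in>Field r. (\<forall>j. (j, i) \<in> r - Id \<longrightarrow> f x j = f y j) \<and> f y i = Suc (f x i) mod N)}"

lemma irrefl_first_difference_digraph:
  assumes "2 \<le> N" "\<And>x i. f x i < N"
  shows "irrefl (first_difference_digraph r N f V)"
proof -
  have "f x i \<noteq> Suc (f x i) mod N" for x i
    using assms(1) assms(2)[of x i] by (cases "Suc (f x i) = N") (auto simp: mod_less)
  then show ?thesis unfolding first_difference_digraph_def irrefl_def by auto
qed

lemma first_difference_digraph_long_cycles:
  assumes r: "Well_order r" and N: "2 \<le> N" "\<And>x i. f x i < N"
    and cyc: "directed_cycle m C" and sub: "C \<subseteq> first_difference_digraph r N f V"
  shows "N \<le> m"
proof -
  obtain v where m: "2 \<le> m" and C: "C = {(v k, v (Suc k mod m)) | k. k < m}"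
    using cyc unfolding directed_cycle_def by blast
  \<comment> \<open>Reducing the index modulo \<open>m\<close> turns the cycle into a closed walk
    with \<open>w m = w 0\<close>.\<close>
  define w where "w k = f (v (k mod m))" for k
  have "\<exists>i\<in>Field r. (\<forall>j. (j, i) \<in> r - Id \<longrightarrow> w k j = w (Suc k) j) \<and> w (Suc k) i = Suc (w k i) mod N"
    if "k < m" for k
  proof -
    have "(v k, v (Suc k mod m)) \<in> first_difference_digraph r N f V" using sub C that by blast
    then show ?thesis using that unfolding first_difference_digraph_def w_def by simp
  qed
  then obtain d where d: "\<And>k. k < m \<Longrightarrow> d k \<in> Field r"
    "\<And>k j. k < m \<Longrightarrow> (j, d k) \<in> r - Id \<Longrightarrow> w k j = w (Suc k) j"
    "\<And>k. k < m \<Longrightarrow> w (Suc k) (d k) = Suc (w k (d k)) mod N"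
    by metis
  have neq: "w (Suc k) (d k) \<noteq> w k (d k)" if "k < m" for k
  proof -
    have "w k (d k) < N" unfolding w_def by (rule N(2))
    then show ?thesis using d(3)[OF that] N(1) by (cases "Suc (w k (d k)) = N") auto
  qed
  have "wf (r - Id)" using r unfolding well_order_on_def by blast
  moreover have "d 0 \<in> d ` {..<m}" using m by simp
  ultimately obtain i where i: "i \<in> d ` {..<m}" and min: "\<And>j. (j, i) \<in> r - Id \<Longrightarrow> j \<notin> d ` {..<m}"
    by (rule wfE_min) blast
  \<comment> \<open>By minimality of \<open>i\<close>, each \<open>d k\<close> is either
    \<open>i\<close> itself, where the entry grows by 1, or a later place, in which case the entry
    at \<open>i\<close> is unchanged.\<close>
  have "w (Suc k) i = w k i \<or> w (Suc k) i = Suc (w k i) mod N" if k: "k < m" for k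
  proof (cases "d k = i")
    case True
    then show ?thesis using d(3)[OF k] by simp
  next
    case False
    have "(d k, i) \<notin> r" using min[of "d k"] k False by blast
    moreover have "i \<in> Field r" using i d(1) by blast
    ultimately have "(i, d k) \<in> r - Id"
      using r d(1)[OF k] False unfolding well_order_on_def linear_order_on_def total_on_def by blast
    then show ?thesis using d(2)[OF k] by simp
  qed
  moreover have "w m i = w 0 i" unfolding w_def by simp
  moreover have "w 0 i < N" unfolding w_def by (rule N(2))
  moreover have "\<exists>k<m. w (Suc k) i \<noteq> w k i" using i neq by blast
  ultimately show ?thesis by (rule cyclic_walk_winds)
qed

text \<open>Raising one entry of \<open>f x\<close> by 1 modulo \<open>N\<close> gives a sequence
  that is again coded in \<open>V\<close>, so every \<open>x\<close> has an outgoing arc.\<close>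

lemma Field_first_difference_digraph:
  assumes "Field r \<noteq> {}" "\<And>x i. f x i < N"
    and onto: "\<And>x. \<forall>i\<in>Field r. x i < N \<Longrightarrow> \<exists>y\<in>V. \<forall>i\<in>Field r. f y i = x i"
  shows "Field (first_difference_digraph r N f V) = V"
proof
  show "Field (first_difference_digraph r N f V) \<subseteq> V"
    unfolding first_difference_digraph_def Field_def by auto
  show "V \<subseteq> Field (first_difference_digraph r N f V)"
  proof
    fix x assume x: "x \<in> V"
    obtain i where i: "i \<in> Field r" using assms(1) by blast
    have "0 < N" using assms(2) by (rule le_less_trans[OF le0])
    then have "\<forall>j\<in>Field r. ((f x)(i := Suc (f x i) mod N)) j < N" using assms(2) by simp
    from onto[OF this] obtain y where y: "y \<in> V"
      "\<forall>j\<in>Field r. f y j = ((f x)(i := Suc (f x i) mod N)) j" by blast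
    have "f x j = f y j" if "(j, i) \<in> r - Id" for j
      using that y(2) FieldI1[of j i r] by simp
    moreover have "f y i = Suc (f x i) mod N" using y(2) i by simp
    ultimately have "(x, y) \<in> first_difference_digraph r N f V"
      using x y(1) i unfolding first_difference_digraph_def by blast
    then show "x \<in> Field (first_difference_digraph r N f V)" by (rule FieldI1)
  qed
qed

lemma first_difference_digraph_not_colourable:
  assumes r: "Well_order r" "Field r \<noteq> {}" and N: "2 \<le> N" "\<And>x i. f x i < N"
    and onto: "\<And>x. \<forall>i\<in>Field r. x i < N \<Longrightarrow> \<exists>y\<in>V. \<forall>i\<in>Field r. f y i = x i"
  shows "\<not> colourable (first_difference_digraph r N f V) r"
proof
  let ?D = "first_difference_digraph r N f V"
  have field: "Field ?D = V" using r(2) N(2) onto by (rule Field_first_difference_digraph)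
  assume "colourable ?D r"
  then obtain c where c: "\<And>x. x \<in> V \<Longrightarrow> c x \<in> Field r"
    "\<And>m C. directed_cycle m C \<Longrightarrow> C \<subseteq> ?D \<Longrightarrow> \<not> monochromatic c C"
    unfolding colourable_def field by blast
  let ?cone = "\<lambda>x i a. {y \<in> V. (\<forall>j. (j, i) \<in> r - Id \<longrightarrow> f y j = x j) \<and> f y i = a}"
  \<comment> \<open>The claim covers all \<open>i\<close> of the type because the recursion below
    does; no vertex has a colour outside \<open>Field r\<close>, so the value 0 serves
    there.\<close>
  have avoid: "\<exists>a<N. \<forall>y \<in> ?cone x i a. c y \<noteq> i" for x i
  proof (cases "i \<in> Field r")
    case False
    then show ?thesis using c(1) N(1) by (intro exI[of _ 0]) auto
  next
    case i: True
    show ?thesis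
    proof (rule ccontr)
      assume "\<not> ?thesis"
      then have "\<forall>a. \<exists>y. a < N \<longrightarrow> y \<in> ?cone x i a \<and> c y = i" by blast
      from choice[OF this]
      obtain v where v: "\<And>a. a < N \<Longrightarrow> v a \<in> ?cone x i a \<and> c (v a) = i" by blast
      \<comment> \<open>The chosen vertices agree before \<open>i\<close> and take each value at
        \<open>i\<close> once, so in cyclic order of these values consecutive ones are joined by
        arcs.\<close>
      let ?C = "{(v k, v (Suc k mod N)) | k. k < N}"
      have "inj_on v {..<N}"
      proof (rule inj_onI)
        fix a b assume "a \<in> {..<N}" "b \<in> {..<N}" "v a = v b"
        then show "a = b" using v[of a] v[of b] by simp
      qed
      then have "directed_cycle N ?C" using N(1) unfolding directed_cycle_def by blast
      moreover have "(v k, v (Suc k mod N)) \<in> ?D" if "k < N" for k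
      proof -
        have "Suc k mod N < N" using that by simp
        then show ?thesis using v[OF that] v[of "Suc k mod N"] i
          unfolding first_difference_digraph_def by (auto intro!: bexI[of _ i])
      qed
      then have "?C \<subseteq> ?D" by blast
      moreover have "c y = i" if "y \<in> Field ?C" for y
        using that v unfolding Field_def by (auto simp: Domain_iff Range_iff)
      then have "monochromatic c ?C" unfolding monochromatic_def by blast
      ultimately show False using c(2) by blast
    qed
  qed
  have "\<exists>x. \<forall>i. x i < N \<and> (\<forall>y \<in> ?cone x i (x i). c y \<noteq> i)"
  \<comment> \<open>The cone at \<open>i\<close> depends on \<open>x\<close> only through its
    entries before \<open>i\<close>, which is what the recursion requires.\<close>
  proof (rule dependent_wf_choice[of "r - Id" "\<lambda>x i a. a < N \<and> (\<forall>y \<in> ?cone x i a. c y \<noteq> i)"])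
    show "wf (r - Id)" using r unfolding well_order_on_def by blast
  qed (use avoid in auto)
  then obtain x where x: "\<And>i. x i < N" "\<And>i y. y \<in> ?cone x i (x i) \<Longrightarrow> c y \<noteq> i" by blast
  obtain y where y: "y \<in> V" "\<forall>i\<in>Field r. f y i = x i" using onto x(1) by blast
  \<comment> \<open>A vertex coding \<open>x\<close> lies in all the chosen cones, in particular in
    the one that avoids its own colour.\<close>
  have "y \<in> ?cone x (c y) (x (c y))" using y c(1) by (auto simp: Field_def)
  then show False using x(2) by blast
qed

theorem theorem2p1:
  fixes \<kappa> :: "'a rel" and n :: nat
  assumes "Card_order \<kappa>" and "cinfinite \<kappa>"
  shows "\<exists>D :: 'a set rel. digraph D \<and> |verts D| =o ctwo ^c \<kappa> \<and>
    cardSuc \<kappa> \<le>o dichromatic_number D \<and>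
    (\<nexists>m C. m < n \<and> directed_cycle m C \<and> C \<subseteq> D)"
proof -
  let ?F = "Field \<kappa>"
  \<comment> \<open>This exceeds \<open>n\<close>, and the summand 2 excludes loops even for
    \<open>n = 0\<close>.\<close>
  define N where "N = n + 2"
  have N: "2 \<le> N" "n < N" unfolding N_def by simp_all
  have inf: "infinite ?F" using assms(2) unfolding cinfinite_def .
  have wo: "Well_order \<kappa>" using assms(1) by (rule card_order_on_well_order_on)
  obtain f :: "'a set \<Rightarrow> 'a \<Rightarrow> nat" where f: "\<And>X i. f X i < N"
    "\<And>x. \<forall>i\<in>?F. x i < N \<Longrightarrow> \<exists>X\<in>Pow ?F. \<forall>i\<in>?F. f X i = x i"
    using ex_onto_bounded_functions[OF inf, of N] N(1) by (auto simp: Bex_def)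
  have nonempty: "?F \<noteq> {}" using inf by auto
  let ?D = "first_difference_digraph \<kappa> N f (Pow ?F)"
  have "Field ?D = Pow ?F" using nonempty f by (rule Field_first_difference_digraph)
  then have "|verts ?D| =o ctwo ^c \<kappa>"
    using card_of_Pow_Func[of ?F] by (simp add: cexp_def ctwo_def Field_card_of)
  moreover have "digraph ?D"
    unfolding digraph_def using N(1) f(1) by (rule irrefl_first_difference_digraph)
  moreover have "cardSuc \<kappa> \<le>o dichromatic_number ?D"
  proof (rule ccontr)
    assume "\<not> ?thesis"
    then have "dichromatic_number ?D <o cardSuc \<kappa>"
      using not_ordLeq_iff_ordLess card_order_on_well_order_on
        cardSuc_Card_order[OF assms(1)] dichromatic_number_Card_order[of ?D] by blast
    then have "dichromatic_number ?D \<le>o \<kappa>"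
      using cardSuc_ordLeq_ordLess[OF assms(1) dichromatic_number_Card_order[of ?D]] by simp
    \<comment> \<open>The order \<open>\<kappa>\<close> now supplies both the places and the
      colours, as the diagonal argument demands.\<close>
    then have "colourable ?D \<kappa>"
      by (rule colourable_mono[OF dichromatic_number_colourable])
    then show False
      using first_difference_digraph_not_colourable[OF wo nonempty N(1) f] by blast
  qed
  moreover have "n < m" if "directed_cycle m C" "C \<subseteq> ?D" for m C
    using first_difference_digraph_long_cycles[OF wo N(1) f(1) that] N(2) by simp
  ultimately show ?thesis by (intro exI[of _ ?D]) (auto dest: less_asym)
qed

end
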